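(* Let $T$ be a tree with at least one edge. Then $\mathrm{ch}'_{\mathrm{star}}(T) \leq \left\lfloor \frac{\theta(T) + \Delta(T)}{2} \right\rfloor$, where $\theta(T) = \max_{xy \in E(T)} \{ d_T(x) + d_T(y) \}$ and $\Delta(T)$ is the maximum degree of $T$.
   Context: A star $k$-edge coloring of a graph $G$ is a proper edge coloring $\phi: E(G) \to \{1,\dots,k\}$ such that no path or cycle of length four (i.e. with four edges) in $G$ is bichromatic. Given a list assignment $L$ assigning a finite set $L(e)$ to each edge $e$, $G$ is star $k$-edge choosable if for every $L$ with $|L(e)| \geq k$ for all $e$ there is a star edge coloring $\varphi$ with $\varphi(e) \in L(e)$ for all $e$. The list star chromatic index $\mathrm{ch}'_{\mathrm{star}}(G)$ is the minimum such $k$. *)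

theory Defs
  imports Main
begin

text \<open>A finite simple graph is given by its vertex set \<open>V\<close> and its set \<open>E\<close> of two-element edges.\<close>

definition simple_graph :: "'a set \<Rightarrow> 'a set set \<Rightarrow> bool" where
  "simple_graph V E \<longleftrightarrow> finite V \<and> (\<forall>e\<in>E. e \<subseteq> V \<and> card e = 2)"

text \<open>Walks, paths and cycles are vertex sequences. The length of \<open>p\<close> is its number of edges,
  \<open>length (walk_edges p)\<close>; the first vertex of a cycle is repeated at the end.\<close>

definition walk_edges :: "'a list \<Rightarrow> 'a set list" where
  "walk_edges p = map2 (\<lambda>u v. {u, v}) p (tl p)"

definition is_walk :: "'a set \<Rightarrow> 'a set set \<Rightarrow> 'a list \<Rightarrow> bool" where
  "is_walk V E p \<longleftrightarrow> p \<noteq> [] \<and> set p \<subseteq> V \<and> set (walk_edges p) \<subseteq> E"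

definition is_path :: "'a set \<Rightarrow> 'a set set \<Rightarrow> 'a list \<Rightarrow> bool" where
  "is_path V E p \<longleftrightarrow> is_walk V E p \<and> distinct p"

definition is_cycle :: "'a set \<Rightarrow> 'a set set \<Rightarrow> 'a list \<Rightarrow> bool" where
  "is_cycle V E p \<longleftrightarrow>
     is_walk V E p \<and> length (walk_edges p) \<ge> 3 \<and> hd p = last p \<and> distinct (tl p)"

definition connected_graph :: "'a set \<Rightarrow> 'a set set \<Rightarrow> bool" where
  "connected_graph V E \<longleftrightarrow>
     V \<noteq> {} \<and> (\<forall>u\<in>V. \<forall>v\<in>V. \<exists>p. is_path V E p \<and> hd p = u \<and> last p = v)"

definition is_tree :: "'a set \<Rightarrow> 'a set set \<Rightarrow> bool" where
  "is_tree V E \<longleftrightarrow> simple_graph V E \<and> connected_graph V E \<and> (\<nexists>p. is_cycle V E p)"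

definition degree :: "'a set set \<Rightarrow> 'a \<Rightarrow> nat" where
  "degree E v = card {e \<in> E. v \<in> e}"

definition max_degree :: "'a set \<Rightarrow> 'a set set \<Rightarrow> nat" where
  "max_degree V E = Max (degree E ` V)"

definition theta :: "'a set set \<Rightarrow> nat" where
  "theta E = Max {degree E x + degree E y | x y. {x, y} \<in> E}"

definition proper_edge_coloring :: "'a set set \<Rightarrow> ('a set \<Rightarrow> nat) \<Rightarrow> bool" where
  "proper_edge_coloring E \<phi> \<longleftrightarrow>
     (\<forall>e\<in>E. \<forall>f\<in>E. e \<noteq> f \<and> e \<inter> f \<noteq> {} \<longrightarrow> \<phi> e \<noteq> \<phi> f)"

definition bichromatic :: "('a set \<Rightarrow> nat) \<Rightarrow> 'a list \<Rightarrow> bool" where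
  "bichromatic \<phi> p \<longleftrightarrow> card (\<phi> ` set (walk_edges p)) = 2"

definition star_edge_coloring :: "'a set \<Rightarrow> 'a set set \<Rightarrow> ('a set \<Rightarrow> nat) \<Rightarrow> bool" where
  "star_edge_coloring V E \<phi> \<longleftrightarrow>
     proper_edge_coloring E \<phi> \<and>
     (\<forall>p. (is_path V E p \<or> is_cycle V E p) \<and> length (walk_edges p) = 4 \<longrightarrow> \<not> bichromatic \<phi> p)"

definition star_edge_choosable :: "'a set \<Rightarrow> 'a set set \<Rightarrow> nat \<Rightarrow> bool" where
  "star_edge_choosable V E k \<longleftrightarrow>
     (\<forall>L :: 'a set \<Rightarrow> nat set. (\<forall>e\<in>E. finite (L e) \<and> card (L e) \<ge> k) \<longrightarrow>
       (\<exists>\<phi>. star_edge_coloring V E \<phi> \<and> (\<forall>e\<in>E. \<phi> e \<in> L e)))"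

definition list_star_chromatic_index :: "'a set \<Rightarrow> 'a set set \<Rightarrow> nat" where
  "list_star_chromatic_index V E = (LEAST k. star_edge_choosable V E k)"

text \<open>The minimum exists for every finite graph: from lists of size \<open>card E\<close> one can give all
  edges different colours.\<close>

lemma ex_inj_choice:
  assumes "finite E" "\<forall>e\<in>E. finite (L e) \<and> card (L e) \<ge> card E"
  shows "\<exists>\<phi>. inj_on \<phi> E \<and> (\<forall>e\<in>E. \<phi> e \<in> L e)"
  using assms
proof (induction E rule: finite_induct)
  case empty
  then show ?case by simp
next
  case (insert e E)
  then obtain \<phi> where \<phi>: "inj_on \<phi> E" "\<forall>e\<in>E. \<phi> e \<in> L e"
    by fastforce
  have "card (\<phi> ` E) < card (L e)"
    using insert.prems insert.hyps card_image_le[of E \<phi>] by fastforce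
  then obtain c where c: "c \<in> L e" "c \<notin> \<phi> ` E"
    using insert.hyps by (metis card_mono finite_imageI not_le subsetI)
  have "inj_on (\<phi>(e := c)) (insert e E)"
    using \<phi>(1) c(2) insert.hyps(2) by (auto simp: inj_on_def)
  moreover have "\<forall>f\<in>insert e E. (\<phi>(e := c)) f \<in> L f"
    using \<phi>(2) c(1) by auto
  ultimately show ?case by blast
qed

lemma star_edge_choosable_card:
  assumes "finite E"
  shows "star_edge_choosable V E (card E)"
  unfolding star_edge_choosable_def
proof (intro allI impI)
  fix L :: "'a set \<Rightarrow> nat set"
  assume "\<forall>e\<in>E. finite (L e) \<and> card (L e) \<ge> card E"
  from ex_inj_choice[OF assms this] obtain \<phi>
    where \<phi>: "inj_on \<phi> E" "\<forall>e\<in>E. \<phi> e \<in> L e" by blast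
  have "\<not> bichromatic \<phi> p"
    if p: "is_path V E p \<or> is_cycle V E p" and len: "length (walk_edges p) = 4" for p
  proof -
    from len have "length p = 5" by (cases p) (auto simp: walk_edges_def)
    then obtain a b c d e where abcde: "p = [a, b, c, d, e]"
      by (auto simp: length_Suc_conv eval_nat_numeral)
    have "distinct [b, c, d]" "a \<notin> {b, c, d}"
      using p by (auto simp: is_path_def is_cycle_def abcde)
    then have "card {{a, b}, {b, c}, {c, d}} = 3"
      by (auto simp: card_insert_if doubleton_eq_iff)
    moreover have "{{a, b}, {b, c}, {c, d}} \<subseteq> set (walk_edges p)"
      by (simp add: abcde walk_edges_def)
    ultimately have "3 \<le> card (set (walk_edges p))"
      by (metis List.finite_set card_mono)
    moreover have "inj_on \<phi> (set (walk_edges p))"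
      using p \<phi>(1) by (auto simp: is_path_def is_cycle_def is_walk_def intro: inj_on_subset)
    ultimately show ?thesis by (simp add: bichromatic_def card_image)
  qed
  moreover have "proper_edge_coloring E \<phi>"
    using \<phi>(1) by (auto simp: proper_edge_coloring_def inj_on_def)
  ultimately show "\<exists>\<phi>. star_edge_coloring V E \<phi> \<and> (\<forall>e\<in>E. \<phi> e \<in> L e)"
    using \<phi>(2) by (auto simp: star_edge_coloring_def)
qed

end

theory Submission
  imports Defs
begin

text \<open>
  Root the tree and colour the edges from the root outwards, one star at a time. A bichromatic
  path of length four with middle vertex \<open>m\<close> exists iff \<open>m\<close> has neighbours \<open>x \<noteq> y\<close> such that the
  colour of \<open>m x\<close> occurs at \<open>y\<close> and the colour of \<open>m y\<close> occurs at \<open>x\<close>. To exclude this, fix a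
  tournament on the neighbours of \<open>m\<close> with all out-degrees at most \<open>d(m) / 2\<close>, and forbid at
  each child \<open>x\<close> the colours of \<open>m y\<close> for the out-neighbours \<open>y\<close> of \<open>x\<close>. The star at \<open>x\<close> can then
  be coloured greedily, since \<open>d(m) div 2 + d(x) \<le> (\<theta> + \<Delta>) div 2\<close>. The star at the
  parent \<open>p\<close> of \<open>m\<close> is already coloured when the star at \<open>m\<close> is, so those children \<open>x\<close> of \<open>m\<close> that
  do not dominate \<open>p\<close> get colours of \<open>m x\<close> avoiding all colours at \<open>p\<close>. As these children are
  dominated by \<open>p\<close>, there are at most \<open>d(m) div 2\<close> of them, and colouring them first succeeds
  because \<open>d(p) + d(m) div 2 \<le> (\<theta> + \<Delta>) div 2\<close>.
\<close>

section \<open>Balanced tournaments and the colouring of one star\<close>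

text \<open>Place the elements on a circle and let each one dominate the \<open>card N div 2\<close>
  elements that follow it. Of two elements, one is reached from the other within half a turn. For
  even \<open>card N\<close>, opposite elements dominate each other.\<close>

lemma ex_balanced_tournament:
  assumes "finite N"
  shows "\<exists>T :: 'b \<Rightarrow> 'b \<Rightarrow> bool.
    (\<forall>x\<in>N. \<forall>y\<in>N. x \<noteq> y \<longrightarrow> T x y \<or> T y x) \<and>
    (\<forall>x\<in>N. card {y \<in> N. T x y} \<le> card N div 2)"
proof -
  define n where "n = card N"
  obtain h where h: "bij_betw h N {0..<n}"
    using ex_bij_betw_finite_nat[OF assms] by (auto simp: n_def)
  define T where "T x y \<longleftrightarrow> h y \<in> (\<lambda>t. (h x + t) mod n) ` {1..n div 2}" for x y
  have lt: "h x < n" if "x \<in> N" for x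
    using bij_betwE[OF h] that by auto
  have inj: "inj_on h N" using h by (rule bij_betw_imp_inj_on)
  have *: "T x y \<or> T y x" if "x \<in> N" "y \<in> N" "h x < h y" for x y
  proof (cases "h y - h x \<le> n div 2")
    case True
    have "h y = (h x + (h y - h x)) mod n" using that lt by simp
    then show ?thesis unfolding T_def using True that(3)
      by (intro disjI1 image_eqI[of _ _ "h y - h x"]) auto
  next
    case False
    \<comment> \<open>The way from \<open>x\<close> to \<open>y\<close> exceeds half a turn, so the
      complementary way from \<open>y\<close> on to \<open>x\<close>, past the point where the
      numbering restarts, has length at most \<open>n div 2\<close>.\<close>
    have "h y + (n - (h y - h x)) = h x + n" using that lt[of y] by linarith
    then have "h x = (h y + (n - (h y - h x))) mod n" using lt[of x] that by simp
    then show ?thesis unfolding T_def using False that(3) lt[of y] that(2)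
      by (intro disjI2 image_eqI[of _ _ "n - (h y - h x)"]) auto
  qed
  have "T x y \<or> T y x" if "x \<in> N" "y \<in> N" "x \<noteq> y" for x y
  proof -
    have "h x \<noteq> h y" using inj that by (auto simp: inj_on_def)
    then show ?thesis using *[of x y] *[of y x] that by (meson linorder_neqE_nat)
  qed
  moreover have "card {y \<in> N. T x y} \<le> n div 2" for x
  proof -
    have "card {y \<in> N. T x y} = card (h ` {y \<in> N. T x y})"
      by (rule card_image[symmetric], rule inj_on_subset[OF inj]) auto
    also have "\<dots> \<le> card ((\<lambda>t. (h x + t) mod n) ` {1..n div 2})"
      by (rule card_mono) (auto simp: T_def)
    also have "\<dots> \<le> card {1..n div 2}" by (rule card_image_le) simp
    finally show ?thesis by simp
  qed
  ultimately show ?thesis unfolding n_def by blast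
qed

text \<open>Deleting \<open>X\<close> from each list leaves at least \<open>card A\<close> colours,
  enough for \<open>ex_inj_choice\<close>.\<close>

lemma ex_inj_choice_avoiding:
  assumes "finite A" "finite X" "card X + card A \<le> k"
    and "\<And>y. y \<in> A \<Longrightarrow> finite (L y) \<and> k \<le> card (L y)"
  shows "\<exists>\<kappa> :: 'b \<Rightarrow> nat. inj_on \<kappa> A \<and> (\<forall>y\<in>A. \<kappa> y \<in> L y) \<and> \<kappa> ` A \<inter> X = {}"
proof -
  have "\<forall>y\<in>A. finite (L y - X) \<and> card A \<le> card (L y - X)"
  proof
    fix y assume "y \<in> A"
    then show "finite (L y - X) \<and> card A \<le> card (L y - X)"
      using assms(3) assms(4)[of y] diff_card_le_card_Diff[OF assms(2), of "L y"] by auto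
  qed
  from ex_inj_choice[OF assms(1) this] show ?thesis by blast
qed

text \<open>Here \<open>A\<close> is the set of children of \<open>m\<close>, \<open>U\<close> is \<open>{m}\<close>, or empty at the root, \<open>P\<close> is the set
  of colours at the parent of \<open>m\<close>, and a non-root vertex stands for the edge to its parent.\<close>

lemma ex_star_extension:
  fixes L :: "'b \<Rightarrow> nat set" and c :: "'b \<Rightarrow> nat"
  assumes "finite A" "finite U" "card U \<le> 1" "A \<inter> U = {}" "finite P" "c ` U \<subseteq> P" "F \<subseteq> P"
    and kP: "card P + card (A \<union> U) div 2 \<le> k" and kF: "card F + card (A \<union> U) \<le> k"
    and L: "\<And>y. y \<in> A \<Longrightarrow> finite (L y) \<and> k \<le> card (L y)"
  shows "\<exists>\<kappa> \<Phi>. (\<forall>u\<in>U. \<kappa> u = c u) \<and> inj_on \<kappa> (A \<union> U) \<and> (\<forall>y\<in>A. \<kappa> y \<in> L y) \<and> \<kappa> ` A \<inter> F = {} \<and>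
    (\<forall>x\<in>A. \<forall>y\<in>A. x \<noteq> y \<longrightarrow> \<kappa> x \<in> \<Phi> y \<or> \<kappa> y \<in> \<Phi> x) \<and>
    (\<forall>u\<in>U. \<forall>y\<in>A. \<kappa> y \<in> P \<longrightarrow> \<kappa> u \<in> \<Phi> y) \<and>
    (\<forall>y\<in>A. \<Phi> y \<subseteq> \<kappa> ` (A \<union> U) \<and> card (\<Phi> y) \<le> card (A \<union> U) div 2)"
proof -
  define N where "N = A \<union> U"
  have finN: "finite N" using assms by (simp add: N_def)
  obtain T where T1: "\<And>x y. x \<in> N \<Longrightarrow> y \<in> N \<Longrightarrow> x \<noteq> y \<Longrightarrow> T x y \<or> T y x"
    and T2: "\<And>x. x \<in> N \<Longrightarrow> card {y \<in> N. T x y} \<le> card N div 2"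
    using ex_balanced_tournament[OF finN] by metis
  have U: "U = {} \<or> (\<exists>u. U = {u})"
    using assms(2,3) by (metis card_0_eq card_1_singletonE le_neq_implies_less less_one)
  \<comment> \<open>\<open>A1\<close> holds the children that do not dominate the parent edge and so
    are dominated by it; at the root it is empty. They are coloured first and avoid all of
    \<open>P\<close>.\<close>
  define A1 where "A1 = {y \<in> A. \<exists>u\<in>U. \<not> T y u}"
  define A2 where "A2 = A - A1"
  have fin12: "finite A1" "finite A2" "A1 \<subseteq> A" "A2 \<subseteq> A" "A1 \<inter> A2 = {}" "A1 \<union> A2 = A"
    using assms(1) by (auto simp: A1_def A2_def)
  have "card A1 \<le> card N div 2"
  proof (cases "U = {}")
    case True then show ?thesis by (simp add: A1_def)
  next
    case False
    then obtain u where u: "U = {u}" using U by auto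
    have "A1 \<subseteq> {y \<in> N. T u y}" using T1 u assms(4) by (auto simp: A1_def N_def)
    then have "card A1 \<le> card {y \<in> N. T u y}" using finN by (intro card_mono) auto
    also have "\<dots> \<le> card N div 2" using T2[of u] u by (simp add: N_def)
    finally show ?thesis .
  qed
  then have "card P + card A1 \<le> k" using kP by (simp add: N_def)
  then obtain \<kappa>1 where \<kappa>1: "inj_on \<kappa>1 A1" "\<forall>y\<in>A1. \<kappa>1 y \<in> L y" "\<kappa>1 ` A1 \<inter> P = {}"
    using ex_inj_choice_avoiding[OF fin12(1) assms(5), of k L] L fin12(3) by blast
  \<comment> \<open>The second round avoids \<open>F\<close>, the colour of the parent edge and the
    colours of the first round. The first two lie in \<open>P\<close>, so the first round avoids
    them as well.\<close>
  define X where "X = F \<union> c ` U \<union> \<kappa>1 ` A1"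
  have finF: "finite F" using assms(5,7) by (rule rev_finite_subset)
  have "card X \<le> card F + card U + card A1"
    unfolding X_def using card_Un_le[of "F \<union> c ` U" "\<kappa>1 ` A1"] card_Un_le[of F "c ` U"]
      card_image_le[OF assms(2), of c] card_image_le[OF fin12(1), of \<kappa>1] by linarith
  moreover have "card (A \<union> U) = card A1 + card A2 + card U"
    using card_Un_disjoint[OF assms(1,2,4)] card_Un_disjoint[OF fin12(1,2,5)] fin12(6) by simp
  ultimately have "card X + card A2 \<le> k" using kF by linarith
  moreover have "finite X" using finF fin12 assms(2) by (simp add: X_def)
  ultimately obtain \<kappa>2 where \<kappa>2: "inj_on \<kappa>2 A2" "\<forall>y\<in>A2. \<kappa>2 y \<in> L y" "\<kappa>2 ` A2 \<inter> X = {}"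
    using ex_inj_choice_avoiding[OF fin12(2), of X k L] L fin12(4) by blast
  define \<kappa> where "\<kappa> y = (if y \<in> A1 then \<kappa>1 y else if y \<in> A2 then \<kappa>2 y else c y)" for y
  have k1: "\<kappa> y = \<kappa>1 y" if "y \<in> A1" for y using that by (simp add: \<kappa>_def)
  have k2: "\<kappa> y = \<kappa>2 y" if "y \<in> A2" for y using that fin12(5) by (auto simp: \<kappa>_def)
  have ku: "\<kappa> u = c u" if "u \<in> U" for u using that fin12(3,4) assms(4) by (auto simp: \<kappa>_def)
  have d12: "\<kappa> x \<noteq> \<kappa> y" if "x \<in> A1" "y \<in> A2" for x y
    using \<kappa>2(3) that by (auto simp: k1 k2 X_def)
  have dU: "\<kappa> y \<noteq> \<kappa> u" if "y \<in> A" "u \<in> U" for y u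
  proof (cases "y \<in> A1")
    case True
    have "c u \<in> P" using assms(6) that(2) by blast
    then show ?thesis using True \<kappa>1(3) by (auto simp: k1 ku[OF that(2)])
  next
    case False
    then have "y \<in> A2" using that(1) by (simp add: A2_def)
    then show ?thesis using \<kappa>2(3) that(2) by (auto simp: k2 ku X_def)
  qed
  have inj: "inj_on \<kappa> (A \<union> U)"
  proof (rule inj_onI)
    fix x y assume xy: "x \<in> A \<union> U" "y \<in> A \<union> U" "\<kappa> x = \<kappa> y"
    consider "x \<in> U" "y \<in> U" | "x \<in> A" "y \<in> U" | "x \<in> U" "y \<in> A" | "x \<in> A1" "y \<in> A1"
      | "x \<in> A1" "y \<in> A2" | "x \<in> A2" "y \<in> A1" | "x \<in> A2" "y \<in> A2"
      using xy fin12(6) by blast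
    then show "x = y"
    proof cases
      case 1 then show ?thesis using U by auto
    next
      case 2 then show ?thesis using dU xy(3) by blast
    next
      case 3 then show ?thesis using dU xy(3) by metis
    next
      case 4 then show ?thesis using \<kappa>1(1) xy(3) by (auto simp: k1 inj_on_def)
    next
      case 5 then show ?thesis using d12 xy(3) by blast
    next
      case 6 then show ?thesis using d12 xy(3) by metis
    next
      case 7 then show ?thesis using \<kappa>2(1) xy(3) by (auto simp: k2 inj_on_def)
    qed
  qed
  \<comment> \<open>The colours of the out-neighbours of \<open>y\<close>: totality of
    \<open>T\<close> yields the pairwise alternative, the out-degree bound yields the
    cardinality.\<close>
  define \<Phi> where "\<Phi> y = \<kappa> ` {x \<in> N. T y x}" for y
  have "\<forall>y\<in>A. \<kappa> y \<in> L y" using \<kappa>1(2) \<kappa>2(2) fin12(6) by (auto simp: k1 k2)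
  moreover have "\<kappa> ` A \<inter> F = {}"
  proof -
    have "\<kappa> y \<notin> F" if "y \<in> A" for y
    proof (cases "y \<in> A1")
      case True then show ?thesis using \<kappa>1(3) assms(7) by (auto simp: k1)
    next
      case False
      then have "y \<in> A2" using that by (simp add: A2_def)
      then show ?thesis using \<kappa>2(3) by (auto simp: k2 X_def)
    qed
    then show ?thesis by auto
  qed
  moreover have "\<forall>x\<in>A. \<forall>y\<in>A. x \<noteq> y \<longrightarrow> \<kappa> x \<in> \<Phi> y \<or> \<kappa> y \<in> \<Phi> x"
    using T1 by (auto simp: \<Phi>_def N_def)
  moreover have "\<kappa> u \<in> \<Phi> y" if "u \<in> U" "y \<in> A" "\<kappa> y \<in> P" for u y
  proof -
    \<comment> \<open>Only second-round children can have a colour in \<open>P\<close>, and those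
      dominate \<open>u\<close>.\<close>
    have "y \<notin> A1" using \<kappa>1(3) that(3) by (auto simp: k1)
    then have "T y u" using that by (auto simp: A1_def)
    then show ?thesis using that by (auto simp: \<Phi>_def N_def)
  qed
  moreover have "\<Phi> y \<subseteq> \<kappa> ` (A \<union> U) \<and> card (\<Phi> y) \<le> card (A \<union> U) div 2" if "y \<in> A" for y
  proof -
    have "card (\<Phi> y) \<le> card {x \<in> N. T y x}"
      unfolding \<Phi>_def using finN by (intro card_image_le) auto
    then show ?thesis using T2[of y] that by (auto simp: \<Phi>_def N_def)
  qed
  ultimately show ?thesis using ku inj
    by (intro exI[of _ \<kappa>] exI[of _ \<Phi>] conjI ballI impI) simp_all
qed

section \<open>Rooted trees given by a parent function\<close>

text \<open>\<open>lev\<close> need not be the depth: its strict decrease along \<open>par\<close>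
  rules out cycles of parents and gives a measure for induction. The value \<open>par r\<close> is
  arbitrary, so \<open>r\<close> is left out wherever vertices stand for edges.\<close>

locale rooted_tree =
  fixes V :: "'a set" and r :: 'a and par :: "'a \<Rightarrow> 'a" and lev :: "'a \<Rightarrow> nat"
  assumes fin: "finite V" and root: "r \<in> V"
    and par_in: "\<And>v. v \<in> V \<Longrightarrow> v \<noteq> r \<Longrightarrow> par v \<in> V"
    and lev_par: "\<And>v. v \<in> V \<Longrightarrow> v \<noteq> r \<Longrightarrow> lev (par v) < lev v"
begin

definition ch :: "'a \<Rightarrow> 'a set" where
  "ch m = {v \<in> V - {r}. par v = m}"

text \<open>The edge from \<open>m\<close> towards the root is represented by its lower end, hence
  by \<open>m\<close> and not by \<open>par m\<close>. The root has no such edge.\<close>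

definition up :: "'a \<Rightarrow> 'a set" where
  "up m = {m} - {r}"

definition star :: "'a \<Rightarrow> 'a set" where
  "star m = ch m \<union> up m"

definition edge :: "'a \<Rightarrow> 'a set" where
  "edge v = {v, par v}"

definition edges :: "'a set set" where
  "edges = edge ` (V - {r})"

lemma finite_ch: "finite (ch m)"
  using fin by (simp add: ch_def)

lemma finite_star: "finite (star m)"
  using finite_ch by (simp add: star_def up_def)

lemma star_subset: "m \<in> V \<Longrightarrow> star m \<subseteq> V - {r}"
  by (auto simp: star_def ch_def up_def)

lemma ch_in_star: "y \<in> ch m \<Longrightarrow> y \<in> star m"
  by (simp add: star_def)

lemma par_neq: "v \<in> V \<Longrightarrow> v \<noteq> r \<Longrightarrow> par v \<noteq> v"
  using lev_par by force

lemma ch_up_disjoint: "ch m \<inter> up m = {}"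
  using par_neq by (auto simp: ch_def up_def)

text \<open>Two different vertices with the same parent edge would be parents of each other, against
  the decrease of \<open>lev\<close>.\<close>

lemma inj_on_edge: "inj_on edge (V - {r})"
proof (rule inj_onI)
  fix v w assume "v \<in> V - {r}" "w \<in> V - {r}" "edge v = edge w"
  then show "v = w" using lev_par[of v] lev_par[of w] by (auto simp: edge_def doubleton_eq_iff)
qed

lemma edges_at: "m \<in> V \<Longrightarrow> {e \<in> edges. m \<in> e} = edge ` star m"
  by (auto simp: edges_def edge_def star_def ch_def up_def)

lemma degree_eq: "m \<in> V \<Longrightarrow> degree edges m = card (star m)"
  unfolding degree_def edges_at
  by (rule card_image) (rule inj_on_subset[OF inj_on_edge star_subset])

lemma edge_cases:
  assumes "{x, y} \<in> edges"
  obtains "y \<in> ch x" "{x, y} = edge y" | "x \<in> ch y" "{x, y} = edge x"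
proof -
  obtain v where v: "v \<in> V - {r}" "{x, y} = edge v" using assms unfolding edges_def by blast
  then have "v = x \<and> par v = y \<or> v = y \<and> par v = x" by (auto simp: edge_def doubleton_eq_iff)
  then show thesis using that v by (auto simp: ch_def)
qed

section \<open>Colouring a rooted tree star by star\<close>

definition par_colours :: "('a \<Rightarrow> nat) \<Rightarrow> 'a \<Rightarrow> nat set" where
  "par_colours c m = (if m = r then {} else c ` star (par m))"

text \<open>Below, \<open>c v\<close> is the colour of the edge from \<open>v\<close> to its parent, and \<open>F v\<close> is the set of
  colours forbidden on the edges from \<open>v\<close> to its children.\<close>

definition good :: "('a \<Rightarrow> nat set) \<Rightarrow> ('a \<Rightarrow> nat) \<Rightarrow> ('a \<Rightarrow> nat set) \<Rightarrow> 'a \<Rightarrow> bool" where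
  "good L c F m \<longleftrightarrow> inj_on c (star m) \<and> (\<forall>y\<in>ch m. c y \<in> L y) \<and> c ` ch m \<inter> F m = {} \<and>
    (\<forall>x\<in>ch m. \<forall>y\<in>ch m. x \<noteq> y \<longrightarrow> c x \<in> F y \<or> c y \<in> F x) \<and>
    (\<forall>u\<in>up m. \<forall>y\<in>ch m. c y \<in> par_colours c m \<longrightarrow> c u \<in> F y) \<and>
    (\<forall>y\<in>ch m. F y \<subseteq> c ` star m \<and> card (F y) \<le> card (star m) div 2)"

text \<open>The condition at \<open>m\<close> involves only the stars at \<open>m\<close> and at its
  parent, so colouring the edges below deeper vertices cannot destroy it.\<close>

lemma good_cong:
  assumes "m \<in> V"
    and "\<And>v. v \<in> V \<Longrightarrow> v \<noteq> r \<Longrightarrow> lev (par v) \<le> lev m \<Longrightarrow> c v = c' v"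
    and "\<And>v. v \<in> V \<Longrightarrow> v = r \<or> lev (par v) \<le> lev m \<Longrightarrow> F v = F' v"
  shows "good L c F m = good L c' F' m"
proof -
  have s: "c v = c' v" if "v \<in> star m" for v
    using that assms(1) lev_par[of m] by (auto intro!: assms(2) simp: star_def ch_def up_def)
  have y: "c v = c' v \<and> F v = F' v" if "v \<in> ch m" for v
    using that s ch_in_star assms(3) by (auto simp: ch_def)
  have m: "F m = F' m"
    using lev_par[OF assms(1)] by (intro assms(3)[OF assms(1)]) linarith
  have p: "par_colours c m = par_colours c' m"
  proof (cases "m = r")
    case False
    have "c v = c' v" if v: "v \<in> star (par m)" for v
    proof -
      have 1: "par m \<in> V" "lev (par m) < lev m" using par_in lev_par assms(1) False by auto
      have 2: "v \<in> V" "v \<noteq> r" using star_subset[OF 1(1)] v by auto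
      have "par v = par m \<or> v = par m" using v by (auto simp: star_def ch_def up_def)
      then have "lev (par v) \<le> lev m" using 1(2) lev_par[OF 2] by auto
      then show ?thesis using assms(2) 2 by blast
    qed
    then show ?thesis using False by (auto simp: par_colours_def)
  qed (simp add: par_colours_def)
  have i: "inj_on c (star m) = inj_on c' (star m)" by (rule inj_on_cong) (rule s)
  have im: "c ` star m = c' ` star m" "c ` ch m = c' ` ch m" using s y by (auto intro!: image_cong)
  have u: "c u = c' u" if "u \<in> up m" for u using s that by (simp add: star_def)
  show ?thesis unfolding good_def p i im m using y u by (auto cong: ball_cong)
qed

text \<open>Induction on the level: all stars centred at level \<open>n\<close> are coloured in one
  round by \<open>ex_star_extension\<close>. The assumptions \<open>k\<close> and \<open>k'\<close>
  supply its two counts below the root, and \<open>kr\<close> supplies them at the root.\<close>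

lemma ex_good:
  fixes L :: "'a \<Rightarrow> nat set"
  assumes k: "\<And>m y. m \<in> V \<Longrightarrow> y \<in> ch m \<Longrightarrow> card (star m) div 2 + card (star y) \<le> k"
    and k': "\<And>m y. m \<in> V \<Longrightarrow> y \<in> ch m \<Longrightarrow> card (star m) + card (star y) div 2 \<le> k"
    and kr: "card (star r) \<le> k"
    and L: "\<And>v. v \<in> V \<Longrightarrow> v \<noteq> r \<Longrightarrow> finite (L v) \<and> k \<le> card (L v)"
  shows "\<exists>c F. \<forall>m\<in>V. good L c F m"
proof -
  \<comment> \<open>No star above the root determines \<open>F r\<close>; keeping it empty reduces
    the counts at the root to \<open>kr\<close>.\<close>
  have "\<exists>c F. F r = {} \<and> (\<forall>m\<in>V. lev m < n \<longrightarrow> good L c F m)" for n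
  proof (induction n)
    case 0 then show ?case by auto
  next
    case (Suc n)
    then obtain c F where Fr: "F r = {}" and g: "\<And>m. m \<in> V \<Longrightarrow> lev m < n \<Longrightarrow> good L c F m"
      by blast
    \<comment> \<open>This is \<open>good\<close> with the data separated: \<open>c\<close> and
      \<open>F\<close> are inherited from earlier rounds, \<kappa> and \<Phi> are chosen for the
      star at \<open>m\<close>.\<close>
    define Q where "Q m \<kappa> \<Phi> \<longleftrightarrow>
        (\<forall>u\<in>up m. \<kappa> u = c u) \<and> inj_on \<kappa> (star m) \<and> (\<forall>y\<in>ch m. \<kappa> y \<in> L y) \<and>
        \<kappa> ` ch m \<inter> F m = {} \<and>
        (\<forall>x\<in>ch m. \<forall>y\<in>ch m. x \<noteq> y \<longrightarrow> \<kappa> x \<in> \<Phi> y \<or> \<kappa> y \<in> \<Phi> x) \<and>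
        (\<forall>u\<in>up m. \<forall>y\<in>ch m. \<kappa> y \<in> par_colours c m \<longrightarrow> \<kappa> u \<in> \<Phi> y) \<and>
        (\<forall>y\<in>ch m. \<Phi> y \<subseteq> \<kappa> ` star m \<and> card (\<Phi> y) \<le> card (star m) div 2)" for m \<kappa> \<Phi>
    have "\<exists>\<kappa> \<Phi>. Q m \<kappa> \<Phi>"
      if m: "m \<in> V" "lev m = n" for m
    proof -
      have "c ` up m \<subseteq> par_colours c m \<and> F m \<subseteq> par_colours c m \<and>
          card (par_colours c m) + card (star m) div 2 \<le> k \<and> card (F m) + card (star m) \<le> k"
      proof (cases "m = r")
        case True
        then show ?thesis using Fr kr by (auto simp: up_def par_colours_def)
      next
        case False
        have mp: "par m \<in> V" "m \<in> ch (par m)" "lev (par m) < n"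
          using m False par_in lev_par[of m] by (auto simp: ch_def)
        have F: "F m \<subseteq> c ` star (par m)" "card (F m) \<le> card (star (par m)) div 2"
          using g[OF mp(1,3)] mp(2) by (auto simp: good_def)
        have "card (c ` star (par m)) \<le> card (star (par m))"
          by (rule card_image_le[OF finite_star])
        moreover have "m \<in> star (par m)" using mp(2) by (rule ch_in_star)
        ultimately show ?thesis
          using F k[OF mp(1,2)] k'[OF mp(1,2)] False by (auto simp: par_colours_def up_def)
      qed
      moreover have "finite (par_colours c m)" by (simp add: par_colours_def finite_star)
      moreover have "finite (up m)" "card (up m) \<le> 1"
        by (auto simp: up_def card_Diff_singleton_if)
      moreover have "finite (L y) \<and> k \<le> card (L y)" if "y \<in> ch m" for y
        using that L by (simp add: ch_def)
      ultimately show ?thesis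
        using ex_star_extension[OF finite_ch, of "up m" m "par_colours c m" c "F m" k L]
          ch_up_disjoint unfolding star_def Q_def by blast
    qed
    then obtain \<kappa> \<Phi> where "\<And>m. m \<in> V \<Longrightarrow> lev m = n \<Longrightarrow> Q m (\<kappa> m) (\<Phi> m)"
      by metis
    note \<kappa> = this[unfolded Q_def]
    \<comment> \<open>The vertices whose parent edges are coloured in this round. Each has only one
      parent, so the choices for different centres do not interfere.\<close>
    define new where "new v \<longleftrightarrow> v \<in> V - {r} \<and> lev (par v) = n" for v
    define c' where "c' v = (if new v then \<kappa> (par v) v else c v)" for v
    define F' where "F' v = (if new v then \<Phi> (par v) v else F v)" for v
    have "F' r = {}" by (simp add: F'_def new_def Fr)
    moreover have "good L c' F' m" if m: "m \<in> V" "lev m < Suc n" for m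
    proof (cases "lev m < n")
      case True
      have "good L c' F' m = good L c F m"
        by (rule good_cong) (use m True in \<open>auto simp: c'_def F'_def new_def\<close>)
      then show ?thesis using g m True by simp
    next
      case False
      then have n: "lev m = n" using m by simp
      have ch: "c' y = \<kappa> m y" "F' y = \<Phi> m y" if "y \<in> ch m" for y
        using that n by (auto simp: c'_def F'_def new_def ch_def)
      \<comment> \<open>The edge above \<open>m\<close>, if there is one, hangs from a vertex of
        smaller level, so its colour and \<open>F m\<close> survive the update.\<close>
      have old: "\<not> new m" using lev_par[of m] n by (auto simp: new_def)
      have up: "c' u = \<kappa> m u" if "u \<in> up m" for u
        using \<kappa>[OF m(1) n] old that by (auto simp: c'_def up_def)
      have st: "c' v = \<kappa> m v" if "v \<in> star m" for v
        using that ch up by (auto simp: star_def)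
      have Fm: "F' m = F m" using old by (simp add: F'_def)
      have p: "par_colours c' m = par_colours c m"
      proof (cases "m = r")
        case False
        have "c' v = c v" if v: "v \<in> star (par m)" for v
        proof -
          have 1: "par m \<in> V" "lev (par m) < n" using par_in lev_par[of m] m(1) False n by auto
          have 2: "v \<in> V" "v \<noteq> r" using star_subset[OF 1(1)] v by auto
          have "par v = par m \<or> v = par m" using v by (auto simp: star_def ch_def up_def)
          then have "lev (par v) < n" using 1(2) lev_par[OF 2] by auto
          then show ?thesis by (simp add: c'_def new_def)
        qed
        then show ?thesis using False by (auto simp: par_colours_def)
      qed (simp add: par_colours_def)
      have i: "inj_on c' (star m) = inj_on (\<kappa> m) (star m)" by (rule inj_on_cong) (rule st)
      have im: "c' ` star m = \<kappa> m ` star m" "c' ` ch m = \<kappa> m ` ch m"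
        using st ch by (auto intro!: image_cong)
      show ?thesis unfolding good_def p i im Fm
        using \<kappa>[OF m(1) n] ch up by (auto cong: ball_cong)
    qed
    ultimately show ?case by blast
  qed
  \<comment> \<open>This bound exceeds every level, so all stars are covered.\<close>
  from this[of "Suc (Max (lev ` V))"] show ?thesis
    using fin by (metis Max_ge finite_imageI imageI le_imp_less_Suc)
qed

section \<open>From vertex colours to a star edge colouring\<close>

definition edge_colouring :: "('a \<Rightarrow> nat) \<Rightarrow> 'a set \<Rightarrow> nat" where
  "edge_colouring c e = c (the_inv_into (V - {r}) edge e)"

lemma edge_colouring_edge: "v \<in> V - {r} \<Longrightarrow> edge_colouring c (edge v) = c v"
  by (simp add: edge_colouring_def the_inv_into_f_f[OF inj_on_edge])

text \<open>Two edges meeting in \<open>m\<close> both belong to the star at \<open>m\<close>, on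
  which \<open>c\<close> is injective.\<close>

lemma proper_edge_colouring:
  assumes "\<And>m. m \<in> V \<Longrightarrow> good L c F m"
  shows "proper_edge_coloring edges (edge_colouring c)"
  unfolding proper_edge_coloring_def
proof (intro ballI impI)
  fix e f assume ef: "e \<in> edges" "f \<in> edges" "e \<noteq> f \<and> e \<inter> f \<noteq> {}"
  then obtain m where m: "m \<in> e" "m \<in> f" by blast
  then have mV: "m \<in> V" using ef(1) par_in by (auto simp: edges_def edge_def)
  have "e \<in> edge ` star m" "f \<in> edge ` star m"
    using ef m by (simp_all flip: edges_at[OF mV])
  then obtain v w where vw: "v \<in> star m" "w \<in> star m" "e = edge v" "f = edge w"
    by (elim imageE)
  have "inj_on c (star m)" using assms[OF mV] by (simp add: good_def)
  then have "c v \<noteq> c w" using vw ef(3) by (auto simp: inj_on_def)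
  moreover have "v \<in> V - {r}" "w \<in> V - {r}" using star_subset[OF mV] vw by auto
  ultimately show "edge_colouring c e \<noteq> edge_colouring c f"
    using vw by (simp add: edge_colouring_edge)
qed

lemma colour_at:
  assumes "m \<in> V" "{x, m} \<in> edges"
  shows "edge_colouring c {x, m} \<in> c ` star m"
proof -
  have "{x, m} \<in> edge ` star m" using edges_at[OF assms(1)] assms(2) by auto
  then show ?thesis using star_subset[OF assms(1)] edge_colouring_edge by fastforce
qed

lemma colour_child: "y \<in> ch m \<Longrightarrow> edge_colouring c {y, m} = c y"
  using edge_colouring_edge[of y c] by (simp add: ch_def edge_def)

text \<open>The only parent of \<open>b\<close> is \<open>m\<close>, so an edge from
  \<open>b\<close> to any other vertex leads downwards.\<close>

lemma edge_child:
  assumes "{a, b} \<in> edges" "b \<in> ch m" "a \<noteq> m"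
  shows "a \<in> ch b"
  using assms(1) by (rule edge_cases) (use assms(2,3) in \<open>auto simp: ch_def\<close>)

text \<open>By symmetry of the path it suffices to treat the case that \<open>d\<close> is a child of the middle
  vertex \<open>m\<close>.\<close>

lemma no_alternating_path_child:
  assumes g: "\<And>m. m \<in> V \<Longrightarrow> good L c F m"
    and E: "{a, b} \<in> edges" "{b, m} \<in> edges" "{d, e} \<in> edges" and d: "d \<in> ch m"
    and V: "b \<in> V" "m \<in> V" "d \<in> V"
    and ne: "a \<noteq> m" "m \<noteq> e" "b \<noteq> d"
    and eq: "edge_colouring c {a, b} = edge_colouring c {m, d}"
      "edge_colouring c {b, m} = edge_colouring c {d, e}"
  shows False
proof -
  have e: "e \<in> ch d" using edge_child[of e d m] E(3) d ne by (simp add: insert_commute)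
  have ce: "edge_colouring c {d, e} = c e" using colour_child[OF e] by (simp add: insert_commute)
  have cd: "edge_colouring c {m, d} = c d" using colour_child[OF d] by (simp add: insert_commute)
  have eF: "c e \<notin> F d" using g[OF V(3)] e by (auto simp: good_def)
  have gm: "good L c F m" by (rule g[OF V(2)])
  from E(2) show False
  \<comment> \<open>If \<open>b\<close> is the parent of \<open>m\<close>, the repeated colour of
    \<open>{a, b}\<close> makes \<open>c d\<close> a colour at the parent, which forces
    \<open>c m\<close> into \<open>F d\<close>. If \<open>b\<close> is a second child of
    \<open>m\<close>, the tournament puts \<open>c b\<close> into \<open>F d\<close> or
    \<open>c d\<close> into \<open>F b\<close>. By alternation, these forbidden colours recur on
    child edges at \<open>d\<close> or \<open>b\<close>.\<close>
  proof (rule edge_cases)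
    assume m: "m \<in> ch b" "{b, m} = edge m"
    then have m': "m \<noteq> r" "par m = b" by (auto simp: ch_def)
    have "c d \<in> par_colours c m"
      using colour_at[OF V(1) E(1), of c] eq cd m' by (simp add: par_colours_def)
    then have "c m \<in> F d" using gm d m' by (auto simp: good_def up_def)
    moreover have "c m = c e" using colour_child[OF m(1)] eq(2) ce by (simp add: insert_commute)
    ultimately show False using eF by simp
  next
    assume b: "b \<in> ch m" "{b, m} = edge b"
    have a: "a \<in> ch b" using edge_child E(1) b ne by blast
    have "c a = c d" using colour_child[OF a] eq(1) cd by simp
    moreover have "c b = c e" using colour_child[OF b(1)] eq(2) ce by simp
    moreover have "c a \<notin> F b" using g[OF V(1)] a by (auto simp: good_def)
    moreover have "c b \<in> F d \<or> c d \<in> F b" using gm b d ne by (auto simp: good_def)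
    ultimately show False using eF by simp
  qed
qed

lemma no_alternating_path:
  assumes g: "\<And>m. m \<in> V \<Longrightarrow> good L c F m"
    and E: "{a, b} \<in> edges" "{b, m} \<in> edges" "{m, d} \<in> edges" "{d, e} \<in> edges"
    and V: "b \<in> V" "m \<in> V" "d \<in> V"
    and ne: "a \<noteq> m" "m \<noteq> e" "b \<noteq> d"
    and eq: "edge_colouring c {a, b} = edge_colouring c {m, d}"
      "edge_colouring c {b, m} = edge_colouring c {d, e}"
  shows False
  using E(3)
proof (rule edge_cases)
  assume "d \<in> ch m"
  then show False using no_alternating_path_child[OF g] E V ne eq by blast
next
  assume d: "m \<in> ch d"
  \<comment> \<open>As \<open>d\<close> is the parent of \<open>m\<close>, the vertex
    \<open>b\<close> must be a child, and the reversed path fits the previous lemma.\<close>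
  from E(2) show False
  proof (rule edge_cases)
    assume "m \<in> ch b" then show False using d ne by (simp add: ch_def)
  next
    assume b: "b \<in> ch m"
    have eqs: "{b, a} = {a, b}" "{d, m} = {m, d}" "{e, d} = {d, e}" "{m, b} = {b, m}" by auto
    show False
      by (rule no_alternating_path_child[OF g, of e d m b a])
        (use b E V ne eq in \<open>auto simp: eqs\<close>)
  qed
qed

text \<open>Acyclicity leaves only paths to consider, and in a proper colouring a bichromatic path
  must alternate between its two colours.\<close>

lemma star_edge_coloring_edge_colouring:
  assumes g: "\<And>m. m \<in> V \<Longrightarrow> good L c F m" and acyclic: "\<nexists>p. is_cycle V edges p"
  shows "star_edge_coloring V edges (edge_colouring c)"
  unfolding star_edge_coloring_def
proof (intro conjI allI impI)
  let ?\<phi> = "edge_colouring c"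
  show proper: "proper_edge_coloring edges ?\<phi>" by (rule proper_edge_colouring[OF g])
  fix p assume p: "(is_path V edges p \<or> is_cycle V edges p) \<and> length (walk_edges p) = 4"
  then have "length p = 5" by (cases p) (auto simp: walk_edges_def)
  then obtain a b m d e where p5: "p = [a, b, m, d, e]"
    by (auto simp: length_Suc_conv eval_nat_numeral)
  have path: "is_path V edges p" using p acyclic by blast
  then have E: "{a, b} \<in> edges" "{b, m} \<in> edges" "{m, d} \<in> edges" "{d, e} \<in> edges"
    and V: "b \<in> V" "m \<in> V" "d \<in> V" and dist: "distinct [a, b, m, d, e]"
    by (auto simp: is_path_def is_walk_def walk_edges_def p5)
  have ne: "?\<phi> {x, y} \<noteq> ?\<phi> {y, z}"
    if "{x, y} \<in> edges" "{y, z} \<in> edges" "x \<noteq> z" for x y z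
  proof -
    have "{x, y} \<noteq> {y, z} \<and> {x, y} \<inter> {y, z} \<noteq> {}"
      using that(3) by (auto simp: doubleton_eq_iff)
    then show ?thesis using proper that(1,2) by (simp add: proper_edge_coloring_def)
  qed
  have n: "?\<phi> {a, b} \<noteq> ?\<phi> {b, m}" "?\<phi> {b, m} \<noteq> ?\<phi> {m, d}" "?\<phi> {m, d} \<noteq> ?\<phi> {d, e}"
    using ne E dist by auto
  show "\<not> bichromatic ?\<phi> p"
  proof
    assume "bichromatic ?\<phi> p"
    then have "card {?\<phi> {a, b}, ?\<phi> {b, m}, ?\<phi> {m, d}, ?\<phi> {d, e}} = 2"
      by (simp add: bichromatic_def p5 walk_edges_def)
    then have "?\<phi> {a, b} = ?\<phi> {m, d}" "?\<phi> {b, m} = ?\<phi> {d, e}"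
      using n by (auto simp: card_insert_if split: if_splits)
    then show False using no_alternating_path[OF g E V] dist by simp
  qed
qed

section \<open>Degree bounds and list sizes\<close>

lemma card_star_bounds:
  assumes "m \<in> V" "y \<in> ch m"
  shows "card (star m) + card (star y) \<le> theta edges"
    and "card (star m) \<le> max_degree V edges" "card (star y) \<le> max_degree V edges"
proof -
  have y: "y \<in> V" using assms(2) by (simp add: ch_def)
  have le: "card (star v) \<le> max_degree V edges" if "v \<in> V" for v
    unfolding max_degree_def degree_eq[OF that, symmetric] using fin that by (intro Max_ge) auto
  then show "card (star m) \<le> max_degree V edges" "card (star y) \<le> max_degree V edges"
    using assms y by auto
  have "{m, y} \<in> edges" using assms(2) by (auto simp: edges_def edge_def ch_def)
  moreover have "edges \<subseteq> Pow V" using par_in by (auto simp: edges_def edge_def)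
  then have "{degree edges x + degree edges y |x y. {x, y} \<in> edges}
      \<subseteq> (\<lambda>(x, y). degree edges x + degree edges y) ` (V \<times> V)"
    by force
  then have "finite {degree edges x + degree edges y |x y. {x, y} \<in> edges}"
    by (rule finite_subset) (simp add: fin)
  ultimately show "card (star m) + card (star y) \<le> theta edges"
    unfolding theta_def degree_eq[OF assms(1), symmetric] degree_eq[OF y, symmetric]
    by (intro Max_ge) auto
qed

lemma star_edge_choosable_edges:
  assumes acyclic: "\<nexists>p. is_cycle V edges p"
  shows "star_edge_choosable V edges ((theta edges + max_degree V edges) div 2)"
    (is "star_edge_choosable _ _ ?k")
  unfolding star_edge_choosable_def
proof (intro allI impI)
  fix L :: "'a set \<Rightarrow> nat set"
  assume L: "\<forall>e\<in>edges. finite (L e) \<and> ?k \<le> card (L e)"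
  have "card (star r) \<le> ?k"
  proof (cases "ch r = {}")
    case True then show ?thesis by (simp add: star_def up_def)
  next
    case False
    then obtain y where y: "y \<in> ch r" by blast
    show ?thesis using card_star_bounds[OF root y] by simp
  qed
  \<comment> \<open>Doubled, each sum consists of both degrees of an edge plus one further degree,
    so it is at most \<theta> + \<Delta> up to rounding down.\<close>
  moreover have "card (star m) div 2 + card (star y) \<le> ?k" "card (star m) + card (star y) div 2 \<le> ?k"
    if "m \<in> V" "y \<in> ch m" for m y
    using card_star_bounds[OF that] by linarith+
  moreover have "finite (L (edge v)) \<and> ?k \<le> card (L (edge v))" if "v \<in> V" "v \<noteq> r" for v
    using L that by (simp add: edges_def)
  ultimately obtain c F where g: "\<And>m. m \<in> V \<Longrightarrow> good (\<lambda>v. L (edge v)) c F m"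
    using ex_good[of ?k "\<lambda>v. L (edge v)"] by blast
  have "edge_colouring c e \<in> L e" if "e \<in> edges" for e
  proof -
    obtain v where v: "v \<in> V - {r}" "e = edge v" using \<open>e \<in> edges\<close> unfolding edges_def by blast
    then have "v \<in> ch (par v)" "par v \<in> V" using par_in by (auto simp: ch_def)
    then have "c v \<in> L (edge v)" using g[of "par v"] by (simp add: good_def)
    then show ?thesis using v by (simp add: edge_colouring_edge)
  qed
  then show "\<exists>\<phi>. star_edge_coloring V edges \<phi> \<and> (\<forall>e\<in>edges. \<phi> e \<in> L e)"
    using star_edge_coloring_edge_colouring[OF g acyclic] by blast
qed

end

section \<open>Paths in trees\<close>

lemma walk_edges_Cons: "p \<noteq> [] \<Longrightarrow> walk_edges (x # p) = {x, hd p} # walk_edges p"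
  by (cases p) (simp_all add: walk_edges_def)

lemma walk_edges_Nil [simp]: "walk_edges [] = []"
  and walk_edges_single [simp]: "walk_edges [x] = []"
  by (simp_all add: walk_edges_def)

lemma walk_edges_append:
  "p \<noteq> [] \<Longrightarrow> q \<noteq> [] \<Longrightarrow> walk_edges (p @ q) = walk_edges p @ {last p, hd q} # walk_edges q"
  by (induction p) (auto simp: walk_edges_Cons)

lemma length_walk_edges: "length (walk_edges p) = length p - 1"
  by (simp add: walk_edges_def)

lemma is_path_append:
  assumes "p \<noteq> []" "q \<noteq> []"
  shows "is_path V E (p @ q) \<longleftrightarrow>
    is_path V E p \<and> is_path V E q \<and> {last p, hd q} \<in> E \<and> set p \<inter> set q = {}"
  using assms by (auto simp: is_path_def is_walk_def walk_edges_append)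

lemma is_path_single [simp]: "is_path V E [x] \<longleftrightarrow> x \<in> V"
  by (simp add: is_path_def is_walk_def)

text \<open>If \<open>y\<close> were not the predecessor of \<open>x\<close>, the part of the path
  from \<open>y\<close> to \<open>x\<close> would have at least two edges, and \<open>{x, y}\<close>
  would close it to a cycle.\<close>

lemma path_closing_edge:
  assumes acyclic: "\<nexists>p. is_cycle V E p"
    and p: "is_path V E (p @ [x])" and y: "y \<in> set p" and xy: "{x, y} \<in> E"
  shows "last p = y"
proof (rule ccontr)
  assume neq: "last p \<noteq> y"
  obtain p1 p2 where p12: "p = p1 @ y # p2" using y by (auto simp: in_set_conv_decomp)
  with neq have p2: "p2 \<noteq> []" by auto
  have "is_path V E (y # p2 @ [x])"
    using p is_path_append[of p1 "y # p2 @ [x]"] by (cases "p1 = []") (auto simp: p12)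
  then have q: "is_walk V E (y # p2 @ [x])" "distinct (y # p2 @ [x])" by (auto simp: is_path_def)
  have "walk_edges ((y # p2 @ [x]) @ [y]) = walk_edges (y # p2 @ [x]) @ [{x, y}]"
    by (subst walk_edges_append) auto
  then have "is_walk V E ((y # p2 @ [x]) @ [y])" using q(1) xy by (auto simp: is_walk_def)
  moreover have "length p2 \<ge> 1" using p2 by (cases p2) auto
  ultimately have "is_cycle V E ((y # p2 @ [x]) @ [y])"
    using q(2) by (auto simp: is_cycle_def length_walk_edges)
  then show False using acyclic by blast
qed

text \<open>Induction removing the common last vertex \<open>b\<close>, with a case split on whether
  the predecessor of \<open>b\<close> on \<open>q\<close> also lies on the other path.\<close>

lemma path_unique:
  assumes acyclic: "\<nexists>p. is_cycle V E p"
    and "is_path V E q" "is_path V E p" "hd p = hd q" "last p = last q"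
  shows "p = q"
  using assms(2-)
proof (induction q arbitrary: p rule: rev_induct)
  case Nil
  then show ?case by (simp add: is_path_def is_walk_def)
next
  case (snoc b q)
  have "p \<noteq> []" using snoc.prems(2) by (simp add: is_path_def is_walk_def)
  then obtain p' where p: "p = p' @ [b]" using snoc.prems(4) by (metis append_butlast_last_id last_snoc)
  have dist: "distinct p" "distinct (q @ [b])" using snoc.prems(1,2) by (auto simp: is_path_def)
  show ?case
  proof (cases "q = [] \<or> p' = []")
    case True
    then show ?thesis using snoc.prems(3) dist unfolding p by (cases q; cases p') auto
  next
    case False
    then have ne: "q \<noteq> []" "p' \<noteq> []" by auto
    have q: "is_path V E q" "{last q, b} \<in> E" "b \<notin> set q" "b \<in> V"
      using snoc.prems(1) by (auto simp: is_path_append ne)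
    have p': "is_path V E p'" "hd p' = hd q"
      using snoc.prems(2,3) by (auto simp: is_path_append ne p)
    show ?thesis
    proof (cases "last q \<in> set p'")
      case True
      \<comment> \<open>The edge from \<open>b\<close> to \<open>last q\<close> closes no cycle, so
        both paths have the same predecessor of \<open>b\<close>.\<close>
      then have "last p' = last q"
        using path_closing_edge[OF acyclic, of p' b "last q"] snoc.prems(2) q(2)
        by (simp add: p insert_commute)
      then show ?thesis using snoc.IH[OF q(1) p'] p by simp
    next
      case False
      have lq: "last q \<in> V" "last q \<noteq> b"
        using q ne last_in_set[OF ne(1)] by (auto simp: is_path_def is_walk_def)
      \<comment> \<open>Otherwise \<open>p\<close> can be prolonged to \<open>last q\<close>; by
        induction the result is \<open>q\<close>, which would then contain \<open>b\<close>.\<close>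
      have "is_path V E (p @ [last q])"
        using snoc.prems(2) False lq q(2) by (subst is_path_append) (auto simp: p insert_commute)
      then have "p @ [last q] = q"
        using snoc.IH[OF q(1), of "p @ [last q]"] p'(2) ne by (simp add: p)
      moreover have "b \<in> set (p @ [last q])" by (simp add: p)
      ultimately have "b \<in> set q" by simp
      then show ?thesis using q(3) by simp
    qed
  qed
qed

section \<open>Rooting a tree\<close>

lemma tree_rooted_tree:
  assumes "is_tree V E"
  shows "\<exists>r par lev. rooted_tree V r par lev \<and> E = rooted_tree.edges V r par"
proof -
  have sg: "finite V" "\<And>e. e \<in> E \<Longrightarrow> e \<subseteq> V \<and> card e = 2"
    and acyclic: "\<nexists>p. is_cycle V E p" and conn: "connected_graph V E"
    using assms by (auto simp: is_tree_def simple_graph_def)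
  obtain r where r: "r \<in> V" using conn by (auto simp: connected_graph_def)
  define path where "path v = (SOME p. is_path V E p \<and> hd p = r \<and> last p = v)" for v
  have path: "is_path V E (path v) \<and> hd (path v) = r \<and> last (path v) = v" if "v \<in> V" for v
  proof -
    have "\<exists>p. is_path V E p \<and> hd p = r \<and> last p = v"
      using conn r that by (simp add: connected_graph_def)
    then show ?thesis unfolding path_def by (rule someI_ex)
  qed
  have path_eq: "path v = p" if "is_path V E p" "hd p = r" "last p = v" for p v
  proof -
    have "v \<in> V" using that last_in_set[of p] by (auto simp: is_path_def is_walk_def)
    then show ?thesis using path_unique[OF acyclic that(1), of "path v"] path[of v] that by simp
  qed
  \<comment> \<open>The parent is the next-to-last vertex on the unique path from \<open>r\<close>;
    the length of this path serves as level. The value at \<open>r\<close> is arbitrary.\<close>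
  define par where "par v = last (butlast (path v))" for v
  have step: "path v = path (par v) @ [v] \<and> par v \<in> V \<and> {v, par v} \<in> E" if v: "v \<in> V" "v \<noteq> r" for v
  proof -
    have "path v \<noteq> []" using path[OF v(1)] by (simp add: is_path_def is_walk_def)
    then have *: "path v = butlast (path v) @ [v]"
      using path[OF v(1)] by (metis append_butlast_last_id)
    define q where "q = butlast (path v)"
    have q: "path v = q @ [v]" using * by (simp add: q_def)
    have "q \<noteq> []" using path[OF v(1)] v(2) by (auto simp: q)
    then have "is_path V E q" "hd q = r" "{last q, v} \<in> E"
      using path[OF v(1)] by (auto simp: q is_path_append)
    moreover from this have "path (last q) = q" using path_eq by blast
    moreover have "last q \<in> V" using \<open>{last q, v} \<in> E\<close> sg(2) by blast
    moreover have "par v = last q" by (simp add: par_def q_def)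
    ultimately show ?thesis using q by (simp add: insert_commute)
  qed
  have rt: "rooted_tree V r par (\<lambda>v. length (path v))"
  proof
    show "length (path (par v)) < length (path v)" if "v \<in> V" "v \<noteq> r" for v
      using step[OF that] by (metis length_append_singleton lessI)
  qed (use sg(1) r step in auto)
  \<comment> \<open>A vertex adjacent to \<open>x\<close> but off its path prolongs that path; by
    uniqueness this is the path to \<open>y\<close>.\<close>
  have extend: "path y = path x @ [y]"
    if "x \<in> V" "y \<in> V" "{x, y} \<in> E" "y \<notin> set (path x)" for x y
  proof (rule path_eq)
    have ne: "path x \<noteq> []" using path[OF that(1)] by (simp add: is_path_def is_walk_def)
    show "is_path V E (path x @ [y])" using path[OF that(1)] that ne by (simp add: is_path_append)
    show "hd (path x @ [y]) = r" using path[OF that(1)] ne by simp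
  qed simp
  have child: "par y = x \<and> y \<noteq> r"
    if "x \<in> V" "y \<in> V" "{x, y} \<in> E" "y \<notin> set (path x)" for x y
  proof -
    have "path x \<noteq> []" "hd (path x) = r" using path[OF that(1)] by (auto simp: is_path_def is_walk_def)
    then have "r \<in> set (path x)" using hd_in_set by metis
    then show ?thesis using extend[OF that] that(4) path[OF that(1)] by (auto simp: par_def)
  qed
  have "e \<in> (\<lambda>v. {v, par v}) ` (V - {r})" if e: "e \<in> E" for e
  proof -
    obtain x y where xy: "e = {x, y}" "x \<noteq> y" using sg(2)[OF e] by (auto simp: card_2_iff)
    have V: "x \<in> V" "y \<in> V" using sg(2)[OF e] xy by auto
    show ?thesis
    \<comment> \<open>This decides which end of the edge is the child: off the path to
      \<open>x\<close>, \<open>y\<close> is a child of \<open>x\<close>; on it, \<open>y\<close>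
      precedes \<open>x\<close> because the edge closes no cycle.\<close>
    proof (cases "y \<in> set (path x)")
      case False
      then have "par y = x \<and> y \<noteq> r" using child V e xy by blast
      then show ?thesis using V xy by auto
    next
      case True
      have xr: "x \<noteq> r"
      proof
        assume "x = r"
        then have "path x = [x]" using r by (intro path_eq) auto
        then show False using True xy by simp
      qed
      have st: "path x = path (par x) @ [x]" "par x \<in> V" using step[OF V(1) xr] by auto
      have "last (path (par x)) = y"
        by (rule path_closing_edge[OF acyclic, of _ x]) (use path[OF V(1)] st True e xy in auto)
      then have "par x = y" using path[OF st(2)] by simp
      then show ?thesis using V xy xr by auto
    qed
  qed
  moreover have "{v, par v} \<in> E" if "v \<in> V" "v \<noteq> r" for v using step[OF that] by blast
  ultimately have "E = rooted_tree.edges V r par"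
    unfolding rooted_tree.edges_def[OF rt] rooted_tree.edge_def[OF rt, abs_def] by auto
  then show ?thesis using rt by blast
qed

theorem theorem15:
  fixes V :: "'a set" and E :: "'a set set"
  assumes "is_tree V E" and "E \<noteq> {}"
  shows "list_star_chromatic_index V E \<le> (theta E + max_degree V E) div 2"
proof -
  obtain r par lev where rt: "rooted_tree V r par lev" and E: "E = rooted_tree.edges V r par"
    using tree_rooted_tree[OF assms(1)] by blast
  have "star_edge_choosable V E ((theta E + max_degree V E) div 2)"
    using rooted_tree.star_edge_choosable_edges[OF rt] assms(1) by (simp add: E is_tree_def)
  then show ?thesis unfolding list_star_chromatic_index_def by (rule Least_le)
qed

end
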